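(* Let $X\subseteq\mathbb{R}^m$, $f=(f_1,\dots,f_d)$ with $f_i:\mathbb{R}^m\to\mathbb{R}$ and $f(X)\subseteq[f^L,f^U]$, and $\phi:\mathbb{R}^d\to\mathbb{R}$. Let $a\in\mathbb{R}^{d\times(n+1)}$ with $f_i^L=a_{i0}<\cdots<a_{in}=f_i^U$, integers $0=\tau(i,0)<\cdots<\tau(i,l_i)=n$ for each $i$, and $\mathcal{H}=\{\prod_{i=1}^d[a_{i\tau(i,t_i-1)},a_{i\tau(i,t_i)}]\mid t\in\prod_i\{1,\dots,l_i\}\}$. Let $u=(u_{ij}):\mathbb{R}^m\to\mathbb{R}^{d\times(n+1)}$ be a vector of convex functions such that for all $x\in X$ and all $i,j$: $u_{ij}(x)\le\min\{f_i(x),a_{ij}\}$, $u_{i0}(x)=a_{i0}$, $u_{in}(x)=f_i(x)$. Let $W$ be a convex outer-approximation of $\{(x,f(x))\mid x\in X\}$. Let $(\bar x,\bar f)\in W$ and let $\bar t=(\bar t_1,\dots,\bar t_d)$ be a vector of indices such that $\bar f\in\bar H=\prod_{i=1}^d[a_{i\tau(i,\bar t_i-1)},a_{i\tau(i,\bar t_i)}]$. For each $i$ define vectors indexed by $j\in\{0,\dots,n\}$: $$\bar u_{ij}=\begin{cases} \bar f_i & j=n \\ u_{ij}(\bar x) & j<n \end{cases},\qquad \hat u_{ij}=\begin{cases} a_{ij} & j\le\tau(i,\bar t_i-1) \\ \bar f_i & j\ge\tau(i,\bar t_i) \\ -\infty & \text{otherwise} \end{cases},\qquad u_i^*=\bar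 u_i\vee\hat u_i,$$ where $\vee$ is the componentwise maximum. Then $\varphi(\bar x,\bar f)=\mathrm{conc}_Q(\bar\phi)(\bar s)$, $\varphi_{\mathcal{H}-}(\bar x,\bar f)=\mathrm{conc}_Q(\bar\phi)(\hat s)$ and $\varphi_{\mathcal{H}}(\bar x,\bar f)=\mathrm{conc}_Q(\bar\phi)(s^* )$, where for all $i,j$: $\bar s_{ij}=\mathrm{conc}(\xi_{i,a_i})(a_{ij};\bar u_i)$, $\hat s_{ij}=\mathrm{conc}(\xi_{i,a_i})(a_{ij};\hat u_i)$, $s^*_{ij}=\mathrm{conc}(\xi_{i,a_i})(a_{ij};u_i^* )$. Moreover, $\varphi_{\mathcal{H}}(\bar x,\bar f)\le\varphi(\bar x,\bar f)$ and $\varphi_{\mathcal{H}}(\bar x,\bar f)\le\varphi_{\mathcal{H}-}(\bar x,\bar f)$.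
   Context: $s=(s_1,\dots,s_d)$, $s_i=(s_{i0},\dots,s_{in})$, $s_{\cdot n}=(s_{1n},\dots,s_{dn})$, $\bar\phi(s)=\phi(s_{1n},\dots,s_{dn})$. $Q=\prod_iQ_i$, where $Q_i$ is the simplex with vertices $v_{ij}=(a_{i0},\dots,a_{i,j-1},a_{ij},\dots,a_{ij})\in\mathbb{R}^{n+1}$, $j=0,\dots,n$; $\mathrm{conc}_Q(\bar\phi)$ is the concave envelope of $\bar\phi$ over $Q$. $\Delta_i=\{z_i\in\mathbb{R}^{n+1}\mid1=z_{i0}\ge\cdots\ge z_{in}\ge0\}$. $Z(s)=z$ with $z_{i0}=1$ and $z_{ij}=(s_{ij}-s_{i,j-1})/(a_{ij}-a_{i,j-1})$ for $j\ge1$. Let (INC) denote the constraints on $(z,\delta)$: $z_i\in\Delta_i$, $\delta_{it}\in\{0,1\}$, $z_{i\tau(i,t)}\ge\delta_{it}\ge z_{i\tau(i,t)+1}$ for $1\le i\le d$, $1\le t\le l_i-1$. For $(x,s_{\cdot n})\in W$ (the coordinates $x$ and $s_{\cdot n}$ are given; the maxima are over the remaining entries of $s\in Q$, and over $\delta$ where it appears): $$\varphi(x,s_{\cdot n})=\max\{\mathrm{conc}_Q(\bar\phi)(s)\mid u(x)\le s,\ (x,s_{\cdot n})\in W\},$$ $$\varphi_{\mathcal{H}-}(x,s_{\cdot n})=\max\{\mathrm{conc}_Q(\bar\phi)(s)\mid(Z(s),\delta)\in(\mathrm{INC}),\ (x,s_{\cdot n})\in W\},$$ $$\varphi_{\mathcal{H}}(x,s_{\cdot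 n})=\max\{\mathrm{conc}_Q(\bar\phi)(s)\mid(Z(s),\delta)\in(\mathrm{INC}),\ u(x)\le s,\ (x,s_{\cdot n})\in W\}.$$ For a vector $u_i=(u_{i0},\dots,u_{in})$ with entries in $\mathbb{R}\cup\{-\infty\}$, $\xi_{i,a_i}(\cdot;u_i)$ is the function with $\xi_{i,a_i}(a_{ij};u_i)=u_{ij}$ for $j=0,\dots,n$ and $-\infty$ elsewhere, and $\mathrm{conc}(\xi_{i,a_i})(\cdot;u_i)$ is its concave envelope over $[a_{i0},a_{in}]$.
   Formalization: The equations for φ and φ_H are proved when some s∈Q with s_{·n}=f̄ satisfies u(x̄)≤s (otherwise the maxima are over empty sets); the equation for φ also assumes u_{i0}(x̄)=a_{i0} for all i, without which s̄ is not in Q. *)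

theory Defs
  imports "HOL-Analysis.Analysis" "HOL-Library.Function_Algebras"
begin

text \<open>
  A vector in \<open>\<real>\<^bsup>n+1\<^esup>\<close> with entries indexed by \<open>0, \<dots>, n\<close> is a function \<open>nat \<Rightarrow> real\<close> that
  vanishes beyond \<open>n\<close>, and an element of \<open>\<real>\<^bsup>d \<times> (n+1)\<^esup>\<close> is a function \<open>'d \<Rightarrow> nat \<Rightarrow> real\<close> whose rows
  are such vectors. The pointwise vector space structure makes \<^const>\<open>convex\<close> and \<^const>\<open>hull\<close>
  available for them.
\<close>

instantiation "fun" :: (type, real_vector) real_vector
begin

definition scaleR_fun :: "real \<Rightarrow> ('a \<Rightarrow> 'b) \<Rightarrow> 'a \<Rightarrow> 'b" where
  "scaleR_fun c f = (\<lambda>x. c *\<^sub>R f x)"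

instance
  by standard (auto simp: scaleR_fun_def fun_eq_iff algebra_simps)

end

text \<open>
  Concave functions and envelopes are extended-real-valued: \<open>\<xi>\<close> takes the value \<open>-\<infinity>\<close>, and the
  envelope of an arbitrary \<open>\<phi>\<close> may take the value \<open>\<infinity>\<close>. Concavity is convexity of the hypograph,
  which avoids the undefined sum \<open>\<infinity> - \<infinity>\<close>.
\<close>

definition ereal_concave_on :: "'a::real_vector set \<Rightarrow> ('a \<Rightarrow> ereal) \<Rightarrow> bool" where
  "ereal_concave_on S h \<longleftrightarrow> convex {(x, r::real). x \<in> S \<and> ereal r \<le> h x}"

text \<open>
  The least concave majorant of \<open>g\<close> on \<open>S\<close>. Outside \<open>S\<close> the majorants are unconstrained, so the
  envelope is \<open>-\<infinity>\<close> there.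
\<close>

definition conc :: "'a::real_vector set \<Rightarrow> ('a \<Rightarrow> ereal) \<Rightarrow> 'a \<Rightarrow> ereal" where
  "conc S g x = (INF h \<in> {h. ereal_concave_on S h \<and> (\<forall>y\<in>S. g y \<le> h y)}. h x)"

definition simplex_vertex :: "nat \<Rightarrow> (nat \<Rightarrow> real) \<Rightarrow> nat \<Rightarrow> nat \<Rightarrow> real" where
  "simplex_vertex n ai j = (\<lambda>k. if k \<le> n then ai (min k j) else 0)"

definition Q_simplex :: "nat \<Rightarrow> (nat \<Rightarrow> real) \<Rightarrow> (nat \<Rightarrow> real) set" where
  "Q_simplex n ai = convex hull (simplex_vertex n ai ` {0..n})"

definition Q :: "nat \<Rightarrow> ('d \<Rightarrow> nat \<Rightarrow> real) \<Rightarrow> ('d \<Rightarrow> nat \<Rightarrow> real) set" where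
  "Q n a = {s. \<forall>i. s i \<in> Q_simplex n (a i)}"

definition last_col :: "nat \<Rightarrow> ('d::finite \<Rightarrow> nat \<Rightarrow> real) \<Rightarrow> real^'d" where
  "last_col n s = (\<chi> i. s i n)"

definition phi_bar :: "nat \<Rightarrow> (real^'d::finite \<Rightarrow> real) \<Rightarrow> ('d \<Rightarrow> nat \<Rightarrow> real) \<Rightarrow> real" where
  "phi_bar n \<phi> s = \<phi> (last_col n s)"

definition conc_Q ::
  "nat \<Rightarrow> ('d::finite \<Rightarrow> nat \<Rightarrow> real) \<Rightarrow> (real^'d \<Rightarrow> real) \<Rightarrow> ('d \<Rightarrow> nat \<Rightarrow> real) \<Rightarrow> ereal" where
  "conc_Q n a \<phi> = conc (Q n a) (\<lambda>s. ereal (phi_bar n \<phi> s))"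

definition Delta :: "nat \<Rightarrow> (nat \<Rightarrow> real) set" where
  "Delta n = {z. z 0 = 1 \<and> (\<forall>j<n. z j \<ge> z (Suc j)) \<and> z n \<ge> 0 \<and> (\<forall>j>n. z j = 0)}"

definition Z :: "nat \<Rightarrow> ('d \<Rightarrow> nat \<Rightarrow> real) \<Rightarrow> ('d \<Rightarrow> nat \<Rightarrow> real) \<Rightarrow> 'd \<Rightarrow> nat \<Rightarrow> real" where
  "Z n a s = (\<lambda>i j. if j = 0 then 1
                    else if j \<le> n then (s i j - s i (j - 1)) / (a i j - a i (j - 1))
                    else 0)"

definition INC ::
  "nat \<Rightarrow> ('d \<Rightarrow> nat) \<Rightarrow> ('d \<Rightarrow> nat \<Rightarrow> nat) \<Rightarrow> (('d \<Rightarrow> nat \<Rightarrow> real) \<times> ('d \<Rightarrow> nat \<Rightarrow> real)) set" where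
  "INC n l \<tau> = {(z, \<delta>).
     (\<forall>i. z i \<in> Delta n) \<and>
     (\<forall>i. \<forall>t\<in>{1..<l i}. \<delta> i t \<in> {0, 1} \<and> z i (\<tau> i t) \<ge> \<delta> i t \<and> \<delta> i t \<ge> z i (\<tau> i t + 1))}"

definition subcube ::
  "('d::finite \<Rightarrow> nat \<Rightarrow> real) \<Rightarrow> ('d \<Rightarrow> nat \<Rightarrow> nat) \<Rightarrow> ('d \<Rightarrow> nat) \<Rightarrow> (real^'d) set" where
  "subcube a \<tau> t = {y. \<forall>i. y $ i \<in> {a i (\<tau> i (t i - 1)) .. a i (\<tau> i (t i))}}"

text \<open>
  Feasible sets of the three maximization problems at \<open>(x, y)\<close>, where \<open>y\<close> is the prescribed value
  of the last column of \<open>s\<close>.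
\<close>

definition feasible ::
  "nat \<Rightarrow> ('d::finite \<Rightarrow> nat \<Rightarrow> real) \<Rightarrow> (real^'m::finite \<Rightarrow> 'd \<Rightarrow> nat \<Rightarrow> real) \<Rightarrow>
   ((real^'m) \<times> (real^'d)) set \<Rightarrow> real^'m \<Rightarrow> real^'d \<Rightarrow> ('d \<Rightarrow> nat \<Rightarrow> real) set" where
  "feasible n a u W x y =
     {s \<in> Q n a. last_col n s = y \<and> (\<forall>i. \<forall>j\<le>n. u x i j \<le> s i j) \<and> (x, last_col n s) \<in> W}"

definition feasible_Hminus ::
  "nat \<Rightarrow> ('d::finite \<Rightarrow> nat \<Rightarrow> real) \<Rightarrow> ('d \<Rightarrow> nat) \<Rightarrow> ('d \<Rightarrow> nat \<Rightarrow> nat) \<Rightarrow>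
   ((real^'m::finite) \<times> (real^'d)) set \<Rightarrow> real^'m \<Rightarrow> real^'d \<Rightarrow> ('d \<Rightarrow> nat \<Rightarrow> real) set" where
  "feasible_Hminus n a l \<tau> W x y =
     {s \<in> Q n a. last_col n s = y \<and> (\<exists>\<delta>. (Z n a s, \<delta>) \<in> INC n l \<tau>) \<and> (x, last_col n s) \<in> W}"

definition feasible_H ::
  "nat \<Rightarrow> ('d::finite \<Rightarrow> nat \<Rightarrow> real) \<Rightarrow> ('d \<Rightarrow> nat) \<Rightarrow> ('d \<Rightarrow> nat \<Rightarrow> nat) \<Rightarrow>
   (real^'m::finite \<Rightarrow> 'd \<Rightarrow> nat \<Rightarrow> real) \<Rightarrow>
   ((real^'m) \<times> (real^'d)) set \<Rightarrow> real^'m \<Rightarrow> real^'d \<Rightarrow> ('d \<Rightarrow> nat \<Rightarrow> real) set" where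
  "feasible_H n a l \<tau> u W x y =
     {s \<in> Q n a. last_col n s = y \<and> (\<exists>\<delta>. (Z n a s, \<delta>) \<in> INC n l \<tau>) \<and>
        (\<forall>i. \<forall>j\<le>n. u x i j \<le> s i j) \<and> (x, last_col n s) \<in> W}"

text \<open>
  The optimal values, as suprema in \<^typ>\<open>ereal\<close>; an infeasible problem has value \<open>-\<infinity>\<close>. A supremum
  is a maximum exactly when it is attained at a feasible point. Membership of \<open>(x, y)\<close> in \<open>W\<close> alone does
  not make the problems constrained by \<open>u(x) \<le> s\<close> feasible, since \<open>W\<close> may contain points with
  \<open>y\<^sub>i < u\<^sub>i\<^sub>n(x)\<close>.
\<close>

definition varphi ::
  "nat \<Rightarrow> ('d::finite \<Rightarrow> nat \<Rightarrow> real) \<Rightarrow> (real^'d \<Rightarrow> real) \<Rightarrow> (real^'m::finite \<Rightarrow> 'd \<Rightarrow> nat \<Rightarrow> real) \<Rightarrow>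
   ((real^'m) \<times> (real^'d)) set \<Rightarrow> real^'m \<Rightarrow> real^'d \<Rightarrow> ereal" where
  "varphi n a \<phi> u W x y = (SUP s \<in> feasible n a u W x y. conc_Q n a \<phi> s)"

definition varphi_Hminus ::
  "nat \<Rightarrow> ('d::finite \<Rightarrow> nat \<Rightarrow> real) \<Rightarrow> ('d \<Rightarrow> nat) \<Rightarrow> ('d \<Rightarrow> nat \<Rightarrow> nat) \<Rightarrow> (real^'d \<Rightarrow> real) \<Rightarrow>
   ((real^'m::finite) \<times> (real^'d)) set \<Rightarrow> real^'m \<Rightarrow> real^'d \<Rightarrow> ereal" where
  "varphi_Hminus n a l \<tau> \<phi> W x y = (SUP s \<in> feasible_Hminus n a l \<tau> W x y. conc_Q n a \<phi> s)"

definition varphi_H ::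
  "nat \<Rightarrow> ('d::finite \<Rightarrow> nat \<Rightarrow> real) \<Rightarrow> ('d \<Rightarrow> nat) \<Rightarrow> ('d \<Rightarrow> nat \<Rightarrow> nat) \<Rightarrow> (real^'d \<Rightarrow> real) \<Rightarrow>
   (real^'m::finite \<Rightarrow> 'd \<Rightarrow> nat \<Rightarrow> real) \<Rightarrow>
   ((real^'m) \<times> (real^'d)) set \<Rightarrow> real^'m \<Rightarrow> real^'d \<Rightarrow> ereal" where
  "varphi_H n a l \<tau> \<phi> u W x y = (SUP s \<in> feasible_H n a l \<tau> u W x y. conc_Q n a \<phi> s)"

text \<open>
  For strictly increasing \<open>ai\<close> the index set below has at most one element, and
  \<open>Sup {} = -\<infinity>\<close> in \<^typ>\<open>ereal\<close>.
\<close>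

definition xi :: "nat \<Rightarrow> (nat \<Rightarrow> real) \<Rightarrow> (nat \<Rightarrow> ereal) \<Rightarrow> real \<Rightarrow> ereal" where
  "xi n ai ui x = (SUP j \<in> {j. j \<le> n \<and> ai j = x}. ui j)"

definition conc_xi :: "nat \<Rightarrow> (nat \<Rightarrow> real) \<Rightarrow> (nat \<Rightarrow> ereal) \<Rightarrow> real \<Rightarrow> ereal" where
  "conc_xi n ai ui = conc {ai 0..ai n} (xi n ai ui)"

text \<open>
  The matrix with entries \<open>conc(\<xi>)(a\<^sub>i\<^sub>j; w\<^sub>i)\<close>. These values are finite, and the conversion to
  \<^typ>\<open>real\<close> is exact, when \<open>w\<^sub>i\<close> has real first and last entries and no entry \<open>\<infinity>\<close>.
\<close>

definition envelope_matrix ::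
  "nat \<Rightarrow> ('d \<Rightarrow> nat \<Rightarrow> real) \<Rightarrow> ('d \<Rightarrow> nat \<Rightarrow> ereal) \<Rightarrow> 'd \<Rightarrow> nat \<Rightarrow> real" where
  "envelope_matrix n a w =
     (\<lambda>i j. if j \<le> n then real_of_ereal (conc_xi n (a i) (w i) (a i j)) else 0)"

definition u_bar ::
  "nat \<Rightarrow> (real^'m::finite \<Rightarrow> 'd::finite \<Rightarrow> nat \<Rightarrow> real) \<Rightarrow> real^'m \<Rightarrow> real^'d \<Rightarrow> 'd \<Rightarrow> nat \<Rightarrow> ereal" where
  "u_bar n u x y = (\<lambda>i j. if j = n then ereal (y $ i) else ereal (u x i j))"

definition u_hat ::
  "('d::finite \<Rightarrow> nat \<Rightarrow> real) \<Rightarrow> ('d \<Rightarrow> nat \<Rightarrow> nat) \<Rightarrow> ('d \<Rightarrow> nat) \<Rightarrow> real^'d \<Rightarrow> 'd \<Rightarrow> nat \<Rightarrow> ereal" where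
  "u_hat a \<tau> t y = (\<lambda>i j. if j \<le> \<tau> i (t i - 1) then ereal (a i j)
                           else if j \<ge> \<tau> i (t i) then ereal (y $ i)
                           else -\<infinity>)"

definition u_star ::
  "nat \<Rightarrow> ('d::finite \<Rightarrow> nat \<Rightarrow> real) \<Rightarrow> ('d \<Rightarrow> nat \<Rightarrow> nat) \<Rightarrow> ('d \<Rightarrow> nat) \<Rightarrow>
   (real^'m::finite \<Rightarrow> 'd \<Rightarrow> nat \<Rightarrow> real) \<Rightarrow> real^'m \<Rightarrow> real^'d \<Rightarrow> 'd \<Rightarrow> nat \<Rightarrow> ereal" where
  "u_star n a \<tau> t u x y = (\<lambda>i j. max (u_bar n u x y i j) (u_hat a \<tau> t y i j))"

end

theory Submission
  imports Defs
begin

text \<open>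
  Membership in \<open>Q\<^sub>i\<close> means that \<open>a\<^sub>i\<^sub>j \<mapsto> s\<^sub>i\<^sub>j\<close> is concave with slopes in \<open>[0, 1]\<close> and starts at
  \<open>a\<^sub>i\<^sub>0\<close>. On points of \<open>Q\<close> with a common last column, \<open>conc\<^sub>Q\<close> is antitone: if \<open>s \<le> t\<close>, then \<open>t\<close> is
  carried to \<open>s\<close> by finitely many linear maps \<open>T\<close>, each moving one row towards one of its chords.
  Such a \<open>T\<close> maps \<open>Q\<close> to itself and fixes the last column, so composing a concave majorant with \<open>T\<close>
  gives another one, whence \<open>conc\<^sub>Q(t) \<le> conc\<^sub>Q(T t)\<close>. Each of the three feasible sets is of the form
  \<open>{s \<in> Q. last column = y, w \<le> s}\<close>, because (INC) amounts to \<open>u_hat \<le> s\<close>, and the row-wise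
  concave envelope of \<open>w\<close> is its least element.
\<close>

section \<open>Concave sequences with slopes in [0, 1]\<close>

text \<open>For strictly increasing \<open>a\<close> this compares the slopes on both sides of
  \<open>m\<close>, with denominators cleared. Arbitrary triples are allowed so that distant chords
  can be compared directly.\<close>

definition concave_seq :: "nat \<Rightarrow> (nat \<Rightarrow> real) \<Rightarrow> (nat \<Rightarrow> real) \<Rightarrow> bool" where
  "concave_seq n a s \<longleftrightarrow>
     (\<forall>p m q. p < m \<and> m < q \<and> q \<le> n \<longrightarrow> (s q - s m) * (a m - a p) \<le> (s m - s p) * (a q - a m))"

definition slopes01 :: "nat \<Rightarrow> (nat \<Rightarrow> real) \<Rightarrow> (nat \<Rightarrow> real) \<Rightarrow> bool" where
  "slopes01 n a s \<longleftrightarrow> (\<forall>p q. p \<le> q \<and> q \<le> n \<longrightarrow> 0 \<le> s q - s p \<and> s q - s p \<le> a q - a p)"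

lemma concave_seqD:
  "\<lbrakk>concave_seq n a s; p < m; m < q; q \<le> n\<rbrakk>
     \<Longrightarrow> (s q - s m) * (a m - a p) \<le> (s m - s p) * (a q - a m)"
  by (auto simp: concave_seq_def)

lemma slopes01D:
  "\<lbrakk>slopes01 n a s; p \<le> q; q \<le> n\<rbrakk> \<Longrightarrow> 0 \<le> s q - s p \<and> s q - s p \<le> a q - a p"
  by (auto simp: slopes01_def)

lemma strict_mono_on_lessD:
  fixes a :: "nat \<Rightarrow> real"
  shows "\<lbrakk>strict_mono_on {0..n} a; p < q; q \<le> n\<rbrakk> \<Longrightarrow> a p < a q"
  by (auto simp: strict_mono_on_def)

lemma strict_mono_on_leD:
  fixes a :: "nat \<Rightarrow> real"
  shows "\<lbrakk>strict_mono_on {0..n} a; p \<le> q; q \<le> n\<rbrakk> \<Longrightarrow> a p \<le> a q"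
  by (cases "p = q") (auto dest: strict_mono_on_lessD[of n a p q])

lemma concave_seq_combination:
  assumes "concave_seq n a s" "concave_seq n a t" "0 \<le> c" "0 \<le> d"
  shows "concave_seq n a (\<lambda>k. c * s k + d * t k)"
  unfolding concave_seq_def
proof (intro allI impI, elim conjE)
  fix p m q assume h: "p < m" "m < q" "q \<le> n"
  have "c * ((s q - s m) * (a m - a p)) + d * ((t q - t m) * (a m - a p))
      \<le> c * ((s m - s p) * (a q - a m)) + d * ((t m - t p) * (a q - a m))"
    by (intro add_mono mult_left_mono concave_seqD[OF assms(1)] concave_seqD[OF assms(2)] h assms(3,4))
  then show "(c * s q + d * t q - (c * s m + d * t m)) * (a m - a p)
     \<le> (c * s m + d * t m - (c * s p + d * t p)) * (a q - a m)"
    by (simp add: algebra_simps)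
qed

lemma slopes01_combination:
  assumes "slopes01 n a s" "slopes01 n a t" "0 \<le> c" "0 \<le> d" "c + d = 1"
  shows "slopes01 n a (\<lambda>k. c * s k + d * t k)"
  unfolding slopes01_def
proof (intro allI impI, elim conjE)
  fix p q assume h: "p \<le> q" "q \<le> n"
  note S = slopes01D[OF assms(1) h] and T = slopes01D[OF assms(2) h]
  have "0 \<le> c * (s q - s p) + d * (t q - t p)"
    using S T assms(3,4) by (intro add_nonneg_nonneg mult_nonneg_nonneg) auto
  moreover have "c * (s q - s p) + d * (t q - t p) \<le> c * (a q - a p) + d * (a q - a p)"
    using S T assms(3,4) by (intro add_mono mult_left_mono) auto
  moreover have "c * (a q - a p) + d * (a q - a p) = a q - a p"
    using assms(5) by (metis distrib_right mult_1)
  ultimately show "0 \<le> c * s q + d * t q - (c * s p + d * t p) \<and>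
      c * s q + d * t q - (c * s p + d * t p) \<le> a q - a p"
    by (simp add: algebra_simps)
qed

text \<open>At \<open>m\<close> the minimum equals one of the two sequences. The inequality of that
  sequence carries over because passing to the minimum only lowers the values at \<open>p\<close>
  and \<open>q\<close>.\<close>

lemma concave_seq_min:
  assumes a: "strict_mono_on {0..n} a" and "concave_seq n a s" "concave_seq n a t"
  shows "concave_seq n a (\<lambda>k. min (s k) (t k))"
  unfolding concave_seq_def
proof (intro allI impI, elim conjE)
  have *: "(min (s q) (t q) - r m) * (a m - a p) \<le> (r m - min (s p) (t p)) * (a q - a m)"
    if "concave_seq n a r" "r = s \<or> r = t" "p < m" "m < q" "q \<le> n" for r p m q
  proof -
    have pos: "a m - a p \<ge> 0" "a q - a m \<ge> 0"
      using strict_mono_on_lessD[OF a] that by (smt (verit) order_less_imp_le order_trans)+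
    have "(min (s q) (t q) - r m) * (a m - a p) \<le> (r q - r m) * (a m - a p)"
      using that(2) pos by (intro mult_right_mono) auto
    also have "\<dots> \<le> (r m - r p) * (a q - a m)"
      using concave_seqD that by blast
    also have "\<dots> \<le> (r m - min (s p) (t p)) * (a q - a m)"
      using that(2) pos by (intro mult_right_mono) auto
    finally show ?thesis .
  qed
  fix p m q assume h: "p < m" "m < q" "q \<le> n"
  show "(min (s q) (t q) - min (s m) (t m)) * (a m - a p)
      \<le> (min (s m) (t m) - min (s p) (t p)) * (a q - a m)"
    using *[of s p m q] *[of t p m q] h assms(2,3) by (cases "s m \<le> t m") (auto simp: min_def)
qed

lemma slopes01_min:
  assumes "slopes01 n a s" "slopes01 n a t"
  shows "slopes01 n a (\<lambda>k. min (s k) (t k))"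
  unfolding slopes01_def
  using slopes01D[OF assms(1)] slopes01D[OF assms(2)] by (smt (verit) min_def)

lemma concave_seq_affine: "concave_seq n a (\<lambda>k. b + c * (a k - e))"
  by (auto simp: concave_seq_def algebra_simps)

lemma slopes01_affine:
  assumes a: "strict_mono_on {0..n} a" and c: "0 \<le> c" "c \<le> 1"
  shows "slopes01 n a (\<lambda>k. b + c * (a k - e))"
  unfolding slopes01_def
proof (intro allI impI, elim conjE)
  fix p q assume "p \<le> q" "q \<le> n"
  then have "0 \<le> a q - a p" using strict_mono_on_leD[OF a] by auto
  then have "0 \<le> c * (a q - a p)" "c * (a q - a p) \<le> 1 * (a q - a p)"
    using c by (intro mult_nonneg_nonneg mult_right_mono; auto)+
  then show "0 \<le> b + c * (a q - e) - (b + c * (a p - e)) \<and>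
      b + c * (a q - e) - (b + c * (a p - e)) \<le> a q - a p"
    by (simp add: algebra_simps)
qed

section \<open>Membership in the simplex as concavity with slopes in [0, 1]\<close>

text \<open>Exhibits each vertex as the minimum of two affine sequences, with slopes 1 and
  0.\<close>

lemma simplex_vertex_eq:
  assumes a: "strict_mono_on {0..n} a" and "k \<le> n" "j \<le> n"
  shows "simplex_vertex n a j k = min (a k) (a j)"
  using strict_mono_on_leD[OF a, of k j] strict_mono_on_leD[OF a, of j k] assms
  by (auto simp: simplex_vertex_def min_def)

text \<open>From index 1 on the row lists the slopes over consecutive grid intervals: concavity
  keeps them from increasing, and \<open>slopes01\<close> keeps them between 0 and the leading entry
  1.\<close>

lemma Z_row_in_Delta:
  assumes a: "strict_mono_on {0..n} (a i)" and s: "concave_seq n (a i) (s i)" "slopes01 n (a i) (s i)"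
  shows "Z n a s i \<in> Delta n"
proof -
  have pos: "0 < a i (Suc j) - a i j" if "j < n" for j
    using strict_mono_on_lessD[OF a, of j "Suc j"] that by simp
  have sl: "0 \<le> s i (Suc j) - s i j" "s i (Suc j) - s i j \<le> a i (Suc j) - a i j" if "j < n" for j
    using slopes01D[OF s(2), of j "Suc j"] that by simp_all
  have "Z n a s i (Suc j) \<le> Z n a s i j" if j: "j < n" for j
  proof (cases j)
    case 0
    then show ?thesis using pos[of 0] sl[of 0] j by (simp add: Z_def divide_le_eq)
  next
    case (Suc k)
    then show ?thesis
      using concave_seqD[OF s(1), of k j "Suc j"] pos[of k] pos[of j] j
      by (simp add: Z_def frac_le_eq divide_simps)
  qed
  moreover have "Z n a s i n \<ge> 0"
    using pos[of "n - 1"] sl[of "n - 1"] by (cases n) (simp_all add: Z_def)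
  ultimately show ?thesis by (auto simp: Delta_def Z_def)
qed

text \<open>The barycentric weights are explicit: they are the drops \<open>z j - z (Suc j)\<close>
  between consecutive entries of the row \<open>z\<close> of \<open>Z\<close>, nonnegative by
  monotonicity and summing to \<open>z 0 = 1\<close>.\<close>

lemma Q_simplex_of_slopes:
  assumes a: "strict_mono_on {0..n} a" and s: "concave_seq n a s" "slopes01 n a s"
    and ends: "s 0 = a 0" "\<forall>j>n. s j = 0"
  shows "s \<in> Q_simplex n a"
proof -
  \<comment> \<open>\<open>Z\<close> acts on families of rows, so the single row is indexed by
    \<open>unit\<close>.\<close>
  define z where "z = Z n (\<lambda>_::unit. a) (\<lambda>_. s) ()"
  have zD: "z \<in> Delta n"
    unfolding z_def by (rule Z_row_in_Delta) (use a s in auto)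
  have z_step: "s (Suc k) - s k = z (Suc k) * (a (Suc k) - a k)" if "k < n" for k
    using strict_mono_on_lessD[OF a, of k "Suc k"] that by (simp add: z_def Z_def)
  define w where "w j = z j - z (Suc j)" for j
  have w_nonneg: "w j \<ge> 0" if "j \<le> n" for j
    using zD that by (cases "j = n") (auto simp: w_def Delta_def)
  have tail: "(\<Sum>j=k..n. w j) = z k" if "k \<le> n" for k
    using that zD sum_Suc_diff[of k n "\<lambda>j. - z j"]
    by (simp add: w_def Delta_def)
  \<comment> \<open>Coordinate \<open>k\<close> of vertex \<open>j\<close> is
    \<open>a (min k j)\<close>. From \<open>k\<close> to \<open>Suc k\<close> only the vertices
    beyond \<open>k\<close> change, and their total weight is \<open>z (Suc k)\<close>, the slope of
    \<open>s\<close> there.\<close>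
  have val: "(\<Sum>j=0..n. w j * a (min k j)) = s k" if "k \<le> n" for k
    using that
  proof (induction k)
    case 0
    have "(\<Sum>j=0..n. w j * a (min 0 j)) = (\<Sum>j=0..n. w j) * a 0"
      by (simp add: sum_distrib_right)
    then show ?case using tail[of 0] zD ends by (simp add: Delta_def)
  next
    case (Suc k)
    have "(\<Sum>j=0..n. w j * a (min (Suc k) j)) - (\<Sum>j=0..n. w j * a (min k j))
        = (\<Sum>j=0..n. if j \<in> {Suc k..n} then w j * (a (Suc k) - a k) else 0)"
      unfolding sum_subtractf[symmetric]
    proof (intro sum.cong refl)
      fix j
      show "w j * a (min (Suc k) j) - w j * a (min k j)
          = (if j \<in> {Suc k..n} then w j * (a (Suc k) - a k) else 0)" if "j \<in> {0..n}"
        using that by (cases "j \<le> k") (auto simp: min_def algebra_simps)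
    qed
    also have "\<dots> = (\<Sum>j\<in>{Suc k..n}. w j * (a (Suc k) - a k))"
      by (subst sum.inter_restrict[symmetric]) (auto intro!: sum.cong)
    also have "\<dots> = s (Suc k) - s k"
      using tail[of "Suc k"] z_step[of k] Suc.prems by (simp add: sum_distrib_right[symmetric])
    finally show ?case using Suc by simp
  qed
  have inj: "simplex_vertex n a j \<in> Q_simplex n a" if "j \<in> {0..n}" for j
    unfolding Q_simplex_def using that by (intro hull_inc) auto
  have ev: "(\<Sum>j\<in>J. w j *\<^sub>R simplex_vertex n a j) k = (\<Sum>j\<in>J. w j * simplex_vertex n a j k)"
    if "finite J" for J k
    using that by (induction J) (auto simp: scaleR_fun_def)
  have "(\<Sum>j\<in>{0..n}. w j *\<^sub>R simplex_vertex n a j) \<in> Q_simplex n a"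
    using tail[of 0] zD inj w_nonneg
    by (intro convex_sum) (auto simp: Q_simplex_def Delta_def)
  moreover have "(\<Sum>j\<in>{0..n}. w j *\<^sub>R simplex_vertex n a j) = s"
  proof
    fix k
    show "(\<Sum>j\<in>{0..n}. w j *\<^sub>R simplex_vertex n a j) k = s k"
      unfolding ev[OF finite_atLeastAtMost]
      using val[of k] ends by (cases "k \<le> n") (simp_all add: simplex_vertex_def)
  qed
  ultimately show ?thesis by simp
qed

text \<open>The right-hand side describes a convex set containing the vertices, hence their hull;
  the converse is the explicit representation by weights.\<close>

lemma Q_simplex_iff:
  assumes a: "strict_mono_on {0..n} a"
  shows "s \<in> Q_simplex n a \<longleftrightarrow>
    concave_seq n a s \<and> slopes01 n a s \<and> s 0 = a 0 \<and> (\<forall>j>n. s j = 0)"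
proof
  define R where "R = {s. concave_seq n a s \<and> slopes01 n a s \<and> s 0 = a 0 \<and> (\<forall>j>n. s j = 0)}"
  have cvx: "convex R"
  proof (rule convexI)
    fix x y :: "nat \<Rightarrow> real" and c d :: real
    assume h: "x \<in> R" "y \<in> R" "0 \<le> c" "0 \<le> d" "c + d = 1"
    have "c *\<^sub>R x + d *\<^sub>R y = (\<lambda>k. c * x k + d * y k)"
      by (auto simp: fun_eq_iff scaleR_fun_def)
    then show "c *\<^sub>R x + d *\<^sub>R y \<in> R"
      using h concave_seq_combination[of n a x y c d] slopes01_combination[of n a x y c d]
      by (auto simp: R_def distrib_right[symmetric])
  qed
  have vert: "simplex_vertex n a j \<in> R" if j: "j \<le> n" for j
  proof -
    let ?v = "\<lambda>k. min (0 + 1 * (a k - 0)) (a j + 0 * (a k - 0))"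
    have "concave_seq n a ?v" "slopes01 n a ?v"
      by (intro concave_seq_min slopes01_min concave_seq_affine slopes01_affine a; simp)+
    moreover have "simplex_vertex n a j k = ?v k" if "k \<le> n" for k
      using simplex_vertex_eq[OF a that j] by simp
    \<comment> \<open>Both predicates inspect only indices up to \<open>n\<close>.\<close>
    then have "concave_seq n a (simplex_vertex n a j) = concave_seq n a ?v"
      "slopes01 n a (simplex_vertex n a j) = slopes01 n a ?v"
      unfolding concave_seq_def slopes01_def by (smt (verit) order.trans less_imp_le)+
    ultimately have "concave_seq n a (simplex_vertex n a j)" "slopes01 n a (simplex_vertex n a j)"
      by simp_all
    then show ?thesis by (auto simp: R_def simplex_vertex_def)
  qed
  show "concave_seq n a s \<and> slopes01 n a s \<and> s 0 = a 0 \<and> (\<forall>j>n. s j = 0)"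
    if "s \<in> Q_simplex n a"
  proof -
    have "convex hull (simplex_vertex n a ` {0..n}) \<subseteq> R"
      using vert cvx by (intro hull_minimal) auto
    then show ?thesis using that unfolding Q_simplex_def R_def by blast
  qed
  show "s \<in> Q_simplex n a" if "concave_seq n a s \<and> slopes01 n a s \<and> s 0 = a 0 \<and> (\<forall>j>n. s j = 0)"
    using Q_simplex_of_slopes[OF a] that by blast
qed

section \<open>Moving a sequence towards its chords\<close>

definition chord :: "(nat \<Rightarrow> real) \<Rightarrow> nat \<Rightarrow> nat \<Rightarrow> (nat \<Rightarrow> real) \<Rightarrow> nat \<Rightarrow> real" where
  "chord a p q s k = s p + (s q - s p) / (a q - a p) * (a k - a p)"

text \<open>Deciding by the index, not by comparing values, makes the map linear in
  \<open>s\<close>.\<close>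

definition smooth :: "(nat \<Rightarrow> real) \<Rightarrow> nat \<Rightarrow> nat \<Rightarrow> real \<Rightarrow> (nat \<Rightarrow> real) \<Rightarrow> nat \<Rightarrow> real" where
  "smooth a p q \<theta> s k = (if p < k \<and> k < q then (1 - \<theta>) * s k + \<theta> * chord a p q s k else s k)"

lemma chord_combination:
  "chord a p q (\<lambda>k. c * s k + d * t k) k = c * chord a p q s k + d * chord a p q t k"
  by (simp add: chord_def divide_inverse algebra_simps)

lemma smooth_combination:
  "smooth a p q \<theta> (\<lambda>k. c * s k + d * t k) k = c * smooth a p q \<theta> s k + d * smooth a p q \<theta> t k"
  by (simp add: smooth_def chord_combination algebra_simps)

lemma chord_le:
  assumes a: "strict_mono_on {0..n} a" and s: "concave_seq n a s"
    and k: "p < k" "k < q" "q \<le> n"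
  shows "chord a p q s k \<le> s k"
proof -
  have pos: "a q - a p > 0" using strict_mono_on_lessD[OF a, of p q] k by simp
  have "(s q - s p) * (a k - a p) \<le> (s k - s p) * (a q - a p)"
    using concave_seqD[OF s k] by (simp add: algebra_simps)
  then show ?thesis using pos by (simp add: chord_def field_simps)
qed

text \<open>Concavity with \<open>p\<close> as middle index covers \<open>k < p\<close>, and with
  \<open>q\<close> as middle index covers \<open>q < k\<close>.\<close>

lemma chord_ge_outside:
  assumes a: "strict_mono_on {0..n} a" and s: "concave_seq n a s"
    and pq: "p < q" "q \<le> n" and k: "k \<le> p \<or> q \<le> k" "k \<le> n"
  shows "s k \<le> chord a p q s k"
proof -
  have pos: "a q - a p > 0" using strict_mono_on_lessD[OF a, of p q] pq by simp
  have "(s k - s p) * (a q - a p) \<le> (s q - s p) * (a k - a p)"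
    using concave_seqD[OF s, of k p q] concave_seqD[OF s, of p q k] pq k
    by (cases "k = p \<or> k = q") (auto simp: algebra_simps)
  then show ?thesis using pos by (simp add: chord_def field_simps)
qed

text \<open>
  Replacing \<open>s\<close> by its chord on \<open>[p, q]\<close> is taking the minimum with the line through that chord,
  which explains why the concave sequences are preserved.
\<close>

lemma smooth_in_Q_simplex:
  assumes a: "strict_mono_on {0..n} a" and s: "s \<in> Q_simplex n a"
    and pq: "p < q" "q \<le> n" and \<theta>: "0 \<le> \<theta>" "\<theta> \<le> 1"
  shows "smooth a p q \<theta> s \<in> Q_simplex n a"
proof -
  have S: "concave_seq n a s" "slopes01 n a s" "s 0 = a 0" "\<forall>j>n. s j = 0"
    using s Q_simplex_iff[OF a] by auto
  have pos: "a q - a p > 0" using strict_mono_on_lessD[OF a, of p q] pq by simp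
  have sl: "0 \<le> (s q - s p) / (a q - a p)" "(s q - s p) / (a q - a p) \<le> 1"
    using slopes01D[OF S(2), of p q] pq pos by auto
  have L: "concave_seq n a (chord a p q s)" "slopes01 n a (chord a p q s)"
    unfolding chord_def[abs_def] by (intro concave_seq_affine slopes01_affine a sl)+
  define t where "t k = (1 - \<theta>) * s k + \<theta> * min (s k) (chord a p q s k)" for k
  have "concave_seq n a t" "slopes01 n a t"
    unfolding t_def[abs_def]
    by (intro concave_seq_combination slopes01_combination concave_seq_min slopes01_min a S L;
        use \<theta> in simp)+
  moreover have eq: "smooth a p q \<theta> s k = t k" if "k \<le> n" for k
    using chord_le[OF a S(1), of p k q] chord_ge_outside[OF a S(1) pq, of k] pq that
    by (auto simp: smooth_def t_def min_def algebra_simps not_less)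
  then have "concave_seq n a (smooth a p q \<theta> s) = concave_seq n a t"
    "slopes01 n a (smooth a p q \<theta> s) = slopes01 n a t"
    unfolding concave_seq_def slopes01_def by (smt (verit) order.trans less_imp_le)+
  ultimately show ?thesis
    using S pq unfolding Q_simplex_iff[OF a] by (auto simp: smooth_def)
qed

section \<open>Antitonicity of the envelope over \<open>Q\<close>\<close>

text \<open>For a concave majorant \<open>h\<close> of \<open>g\<close>, the function
  \<open>h \<circ> T\<close> is again one: \<open>T\<close> respects convex combinations, so the
  hypograph stays convex, and \<open>g\<close> is invariant under \<open>T\<close>. Hence every
  \<open>h (T x)\<close> bounds \<open>conc S g x\<close> from above.\<close>

lemma conc_le_conc_map:
  assumes T_aff: "\<And>x y c d. 0 \<le> c \<Longrightarrow> 0 \<le> d \<Longrightarrow> c + d = 1 \<Longrightarrow>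
      T (c *\<^sub>R x + d *\<^sub>R y) = c *\<^sub>R T x + d *\<^sub>R T y"
    and S: "convex S" and T_S: "T ` S \<subseteq> S" and g: "\<And>y. y \<in> S \<Longrightarrow> g (T y) = g y"
  shows "conc S g x \<le> conc S g (T x)"
  unfolding conc_def
proof (rule INF_greatest)
  fix h assume "h \<in> {h. ereal_concave_on S h \<and> (\<forall>y\<in>S. g y \<le> h y)}"
  then have h: "convex {(x, r::real). x \<in> S \<and> ereal r \<le> h x}" "\<And>y. y \<in> S \<Longrightarrow> g y \<le> h y"
    by (auto simp: ereal_concave_on_def)
  have "ereal_concave_on S (h \<circ> T)"
    unfolding ereal_concave_on_def
  proof (rule convexI, clarsimp, intro conjI)
    fix x y and r r' c d :: real
    assume *: "x \<in> S" "ereal r \<le> h (T x)" "y \<in> S" "ereal r' \<le> h (T y)"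
      "0 \<le> c" "0 \<le> d" "c + d = 1"
    show "c *\<^sub>R x + d *\<^sub>R y \<in> S" using S * by (auto intro: convexD)
    have "c *\<^sub>R (T x, r) + d *\<^sub>R (T y, r') \<in> {(x, r::real). x \<in> S \<and> ereal r \<le> h x}"
      using * T_S by (intro convexD[OF h(1)]) auto
    then show "ereal (c * r + d * r') \<le> h (T (c *\<^sub>R x + d *\<^sub>R y))"
      using T_aff * by auto
  qed
  moreover have "g y \<le> (h \<circ> T) y" if "y \<in> S" for y
    using h(2)[of "T y"] g that T_S by auto
  ultimately show "(INF h\<in>{h. ereal_concave_on S h \<and> (\<forall>y\<in>S. g y \<le> h y)}. h x) \<le> h (T x)"
    by (intro INF_lower2[of "h \<circ> T"]) auto
qed

lemma convex_Q: "convex (Q n a)"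
proof (rule convexI)
  fix x y and c d :: real
  assume *: "x \<in> Q n a" "y \<in> Q n a" "0 \<le> c" "0 \<le> d" "c + d = 1"
  have "c *\<^sub>R x i + d *\<^sub>R y i \<in> Q_simplex n (a i)" for i
    using * convex_convex_hull unfolding Q_def Q_simplex_def by (blast intro: convexD)
  then show "c *\<^sub>R x + d *\<^sub>R y \<in> Q n a" by (simp add: Q_def scaleR_fun_def)
qed

lemma conc_Q_smooth:
  fixes a :: "'d::finite \<Rightarrow> nat \<Rightarrow> real"
  assumes a: "\<And>i. strict_mono_on {0..n} (a i)"
    and pq: "p < q" "q \<le> n" and \<theta>: "0 \<le> \<theta>" "\<theta> \<le> 1"
  shows "conc_Q n a \<phi> s \<le> conc_Q n a \<phi> (s(i := smooth (a i) p q \<theta> (s i)))"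
  unfolding conc_Q_def
proof (rule conc_le_conc_map[OF _ convex_Q])
  show "(c *\<^sub>R x + d *\<^sub>R y)(i := smooth (a i) p q \<theta> ((c *\<^sub>R x + d *\<^sub>R y) i))
      = c *\<^sub>R x(i := smooth (a i) p q \<theta> (x i)) + d *\<^sub>R y(i := smooth (a i) p q \<theta> (y i))"
    for c d x y
    using smooth_combination[of "a i" p q \<theta> c "x i" d "y i"]
    by (auto simp: fun_eq_iff scaleR_fun_def plus_fun_def)
  show "(\<lambda>s. s(i := smooth (a i) p q \<theta> (s i))) ` Q n a \<subseteq> Q n a"
    using smooth_in_Q_simplex[OF a _ pq \<theta>] by (auto simp: Q_def)
  show "ereal (phi_bar n \<phi> (y(i := smooth (a i) p q \<theta> (y i)))) = ereal (phi_bar n \<phi> y)" for y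
  proof -
    \<comment> \<open>Index \<open>n\<close> is not strictly below \<open>q\<close>, so the entries
      on which \<open>phi_bar\<close> depends stay fixed.\<close>
    have "last_col n (y(i := smooth (a i) p q \<theta> (y i))) = last_col n y"
      using pq by (auto simp: last_col_def vec_eq_iff smooth_def)
    then show ?thesis by (simp add: phi_bar_def)
  qed
qed

text \<open>\<open>p\<close> is the last failure of \<open>P\<close> before \<open>k\<close> and
  \<open>q\<close> the first one after it. Applied to the predicate that two sequences differ, this
  yields an interval with agreement at its ends only.\<close>

lemma maximal_open_run:
  fixes k n :: nat
  assumes "P k" "\<not> P 0" "\<not> P n" "k \<le> n"
  obtains p q where "p < k" "k < q" "q \<le> n" "\<not> P p" "\<not> P q" "\<And>m. p < m \<Longrightarrow> m < q \<Longrightarrow> P m"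
proof -
  define p where "p = (GREATEST m. m \<le> k \<and> \<not> P m)"
  define q where "q = (LEAST m. k \<le> m \<and> \<not> P m)"
  have p: "p \<le> k \<and> \<not> P p" unfolding p_def
    by (rule GreatestI_nat[of _ 0 k]) (use assms in auto)
  have p': "m \<le> p" if "m \<le> k" "\<not> P m" for m unfolding p_def
    by (rule Greatest_le_nat[of _ _ k]) (use that in auto)
  have q: "k \<le> q \<and> \<not> P q" unfolding q_def
    by (rule LeastI[of _ n]) (use assms in auto)
  have q': "q \<le> m" if "k \<le> m" "\<not> P m" for m unfolding q_def
    by (rule Least_le) (use that in auto)
  show ?thesis
  proof (rule that[of p q])
    show "p < k" "k < q" using p q assms(1) by (auto simp: order.order_iff_strict)
    show "q \<le> n" using q' assms by auto
    show "P m" if "p < m" "m < q" for m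
      using p'[of m] q'[of m] that by (cases "m \<le> k") (auto simp: not_le)
  qed (use p q in auto)
qed

text \<open>
  The largest \<open>\<theta>\<close> that keeps the smoothed sequence above \<open>s\<close> makes it touch \<open>s\<close> at a new index.
\<close>

lemma smooth_towards:
  assumes a: "strict_mono_on {0..n} a" and s: "s \<in> Q_simplex n a" and t: "t \<in> Q_simplex n a"
    and le: "\<And>j. s j \<le> t j" and last: "s n = t n" and k: "s k \<noteq> t k"
  obtains p q \<theta> where "p < q" "q \<le> n" "0 \<le> \<theta>" "\<theta> \<le> 1"
    "\<And>j. s j \<le> smooth a p q \<theta> t j"
    "\<And>j. s j = t j \<Longrightarrow> smooth a p q \<theta> t j = t j"
    "\<exists>m\<le>n. s m \<noteq> t m \<and> smooth a p q \<theta> t m = s m"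
proof -
  have S: "concave_seq n a s" "s 0 = a 0" "\<forall>j>n. s j = 0" using s Q_simplex_iff[OF a] by auto
  have T: "t 0 = a 0" "\<forall>j>n. t j = 0" using t Q_simplex_iff[OF a] by auto
  have kn: "k \<le> n" using S T k by (cases "k \<le> n") auto
  obtain p q where pq: "p < k" "k < q" "q \<le> n" "s p = t p" "s q = t q"
    "\<And>m. p < m \<Longrightarrow> m < q \<Longrightarrow> s m \<noteq> t m"
    using maximal_open_run[of "\<lambda>m. s m \<noteq> t m" k n] k S T last kn by metis
  \<comment> \<open>The sequences agree at \<open>p\<close> and \<open>q\<close>, so the chord of
    \<open>t\<close> is also the chord of \<open>s\<close> and lies below \<open>s\<close> by
    concavity.\<close>
  have chord_eq: "chord a p q t = chord a p q s" using pq by (simp add: chord_def[abs_def])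
  have below: "chord a p q t m \<le> s m" "s m < t m" if "m \<in> {p<..<q}" for m
    using chord_le[OF a S(1), of p m q] that pq le[of m] chord_eq by (auto simp: less_le)
  \<comment> \<open>\<open>r m\<close> is the value of \<theta> at which entry \<open>m\<close>
    comes down exactly to \<open>s m\<close>; the minimum is the first contact.\<close>
  define r where "r m = (t m - s m) / (t m - chord a p q t m)" for m
  define \<theta> where "\<theta> = Min (r ` {p<..<q})"
  have ne: "{p<..<q} \<noteq> {}" using pq by auto
  have r01: "0 \<le> r m" "r m \<le> 1" if "m \<in> {p<..<q}" for m
    using below[OF that] by (auto simp: r_def)
  have "\<theta> \<in> r ` {p<..<q}" unfolding \<theta>_def using ne by (intro Min_in) auto
  then obtain m where m: "m \<in> {p<..<q}" "\<theta> = r m" by auto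
  have \<theta>_le: "\<theta> \<le> r j" if "j \<in> {p<..<q}" for j unfolding \<theta>_def using that by (intro Min_le) auto
  show ?thesis
  proof (rule that[of p q \<theta>])
    show "p < q" "q \<le> n" "0 \<le> \<theta>" "\<theta> \<le> 1" using pq m r01 by auto
    show "s j \<le> smooth a p q \<theta> t j" for j
    proof (cases "j \<in> {p<..<q}")
      case True
      have "\<theta> * (t j - chord a p q t j) \<le> t j - s j"
        using \<theta>_le[OF True] below[OF True] by (simp add: r_def pos_le_divide_eq)
      then show ?thesis using True by (simp add: smooth_def algebra_simps)
    qed (use le in \<open>auto simp: smooth_def\<close>)
    show "smooth a p q \<theta> t j = t j" if "s j = t j" for j
      using that pq(6)[of j] by (auto simp: smooth_def)
    have "\<theta> * (t m - chord a p q t m) = t m - s m"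
      using m below[OF m(1)] by (simp add: r_def)
    then show "\<exists>m\<le>n. s m \<noteq> t m \<and> smooth a p q \<theta> t m = s m"
      using m pq by (intro exI[of _ m]) (auto simp: smooth_def algebra_simps)
  qed
qed

text \<open>Induction on the number of entries where \<open>s\<close> and \<open>t\<close> differ. A
  smoothing step towards \<open>s\<close> lowers this number, stays above \<open>s\<close> and does
  not decrease the envelope.\<close>

lemma conc_Q_antimono:
  fixes a :: "'d::finite \<Rightarrow> nat \<Rightarrow> real"
  assumes a: "\<And>i. strict_mono_on {0..n} (a i)"
    and "s \<in> Q n a" "t \<in> Q n a" "\<And>i j. s i j \<le> t i j" "\<And>i. s i n = t i n"
  shows "conc_Q n a \<phi> t \<le> conc_Q n a \<phi> s"
  using assms(2-)
proof (induction "card {(i, j). j \<le> n \<and> s i j \<noteq> t i j}" arbitrary: t rule: less_induct)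
  case less
  have Qrow: "s i \<in> Q_simplex n (a i)" "t i \<in> Q_simplex n (a i)" for i
    using less.prems by (auto simp: Q_def)
  show ?case
  proof (cases "s = t")
    case False
    then obtain i k where k: "s i k \<noteq> t i k" by (auto simp: fun_eq_iff)
    obtain p q \<theta> where pq: "p < q" "q \<le> n" and \<theta>: "0 \<le> \<theta>" "\<theta> \<le> 1"
      and ge: "\<And>j. s i j \<le> smooth (a i) p q \<theta> (t i) j"
      and keep: "\<And>j. s i j = t i j \<Longrightarrow> smooth (a i) p q \<theta> (t i) j = t i j"
      and new: "\<exists>m\<le>n. s i m \<noteq> t i m \<and> smooth (a i) p q \<theta> (t i) m = s i m"
      using smooth_towards[OF a[of i] Qrow[of i] less.prems(3) less.prems(4) k] by metis
    define t' where "t' = t(i := smooth (a i) p q \<theta> (t i))"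
    have fin: "finite {(i, j). j \<le> n \<and> s i j \<noteq> t i j}"
      by (rule finite_subset[of _ "UNIV \<times> {..n}"]) auto
    have "{(i, j). j \<le> n \<and> s i j \<noteq> t' i j} \<subset> {(i, j). j \<le> n \<and> s i j \<noteq> t i j}"
    proof
      show "{(i, j). j \<le> n \<and> s i j \<noteq> t' i j} \<subseteq> {(i, j). j \<le> n \<and> s i j \<noteq> t i j}"
        using keep by (auto simp: t'_def split: if_splits)
      obtain m where "m \<le> n" "s i m \<noteq> t i m" "t' i m = s i m"
        using new by (auto simp: t'_def)
      then have "(i, m) \<in> {(i, j). j \<le> n \<and> s i j \<noteq> t i j} - {(i, j). j \<le> n \<and> s i j \<noteq> t' i j}"
        by auto
      then show "{(i, j). j \<le> n \<and> s i j \<noteq> t' i j} \<noteq> {(i, j). j \<le> n \<and> s i j \<noteq> t i j}"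
        by blast
    qed
    then have "card {(i, j). j \<le> n \<and> s i j \<noteq> t' i j} < card {(i, j). j \<le> n \<and> s i j \<noteq> t i j}"
      using fin by (rule psubset_card_mono[rotated])
    moreover have "t' \<in> Q n a"
      using smooth_in_Q_simplex[OF a Qrow(2) pq \<theta>] Qrow by (auto simp: t'_def Q_def)
    ultimately have "conc_Q n a \<phi> t' \<le> conc_Q n a \<phi> s"
      using less.prems ge keep by (intro less.hyps) (auto simp: t'_def)
    moreover have "conc_Q n a \<phi> t \<le> conc_Q n a \<phi> t'"
      unfolding t'_def by (rule conc_Q_smooth[OF a pq \<theta>])
    ultimately show ?thesis by order
  qed simp
qed

section \<open>Concave envelopes of the nodal functions \<open>xi\<close>\<close>

lemma conc_ge: "y \<in> S \<Longrightarrow> g y \<le> conc S g y"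
  unfolding conc_def by (rule INF_greatest) auto

lemma conc_le: "ereal_concave_on S h \<Longrightarrow> (\<And>y. y \<in> S \<Longrightarrow> g y \<le> h y) \<Longrightarrow> conc S g x \<le> h x"
  unfolding conc_def by (rule INF_lower) auto

text \<open>The hypograph of an infimum is the intersection of the hypographs.\<close>

lemma ereal_concave_on_conc:
  assumes "convex S"
  shows "ereal_concave_on S (conc S g)"
proof -
  have "{(x, r::real). x \<in> S \<and> ereal r \<le> conc S g x}
      = (S \<times> UNIV) \<inter> (\<Inter>h\<in>{h. ereal_concave_on S h \<and> (\<forall>y\<in>S. g y \<le> h y)}.
          {(x, r). x \<in> S \<and> ereal r \<le> h x})"
    by (auto simp: conc_def le_INF_iff)
  moreover have "convex \<dots>"
    using assms by (intro convex_Int convex_Times convex_INT) (auto simp: ereal_concave_on_def)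
  ultimately show ?thesis by (simp add: ereal_concave_on_def)
qed

lemma ereal_concave_on_affine:
  assumes "convex S"
  shows "ereal_concave_on S (\<lambda>x::real. ereal (b + c * (x - e)))"
  unfolding ereal_concave_on_def
proof (rule convexI, clarsimp, intro conjI)
  fix x y r r' v w :: real
  assume *: "x \<in> S" "y \<in> S" "0 \<le> v" "0 \<le> w" "v + w = 1"
    "r \<le> b + c * (x - e)" "r' \<le> b + c * (y - e)"
  show "v * x + w * y \<in> S" using convexD[OF assms *(1-5)] by simp
  have "v * r + w * r' \<le> v * (b + c * (x - e)) + w * (b + c * (y - e))"
    using * by (intro add_mono mult_left_mono) auto
  also have "\<dots> = (v + w) * (b - c * e) + c * (v * x + w * y)"
    by (simp add: algebra_simps)
  finally show "v * r + w * r' \<le> b + c * (v * x + w * y - e)"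
    using * by (simp add: algebra_simps)
qed

lemma xi_grid:
  assumes a: "strict_mono_on {0..n} a" and "j \<le> n"
  shows "xi n a w (a j) = w j"
proof -
  have "k = j" if "k \<le> n" "a k = a j" for k
    using that assms(2) strict_mono_on_lessD[OF a, of k j] strict_mono_on_lessD[OF a, of j k]
    by (cases k j rule: linorder_cases) auto
  then have "{k. k \<le> n \<and> a k = a j} = {j}"
    using assms(2) by auto
  then show ?thesis by (simp add: xi_def)
qed

text \<open>An affine function is a concave majorant as soon as it dominates \<open>w\<close> at the
  nodes, since \<open>xi\<close> is -\<infinity> elsewhere.\<close>

lemma conc_xi_le_affine:
  assumes "\<And>k. k \<le> n \<Longrightarrow> w k \<le> ereal (b + c * (a k - e))"
  shows "conc_xi n a w x \<le> ereal (b + c * (x - e))"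
  unfolding conc_xi_def
proof (rule conc_le[OF ereal_concave_on_affine])
  show "xi n a w y \<le> ereal (b + c * (y - e))" for y
    unfolding xi_def using assms by (auto intro!: SUP_least)
qed simp

text \<open>One line per node suffices: the line through \<open>s\<close> over a grid interval with
  endpoint \<open>a j\<close> lies above \<open>s\<close> at all nodes and equals \<open>s j\<close>
  at \<open>a j\<close>.\<close>

lemma conc_xi_le_concave_seq:
  assumes a: "strict_mono_on {0..n} a" and s: "concave_seq n a s"
    and w: "\<And>k. k \<le> n \<Longrightarrow> w k \<le> ereal (s k)" and j: "j \<le> n" and n: "0 < n"
  shows "conc_xi n a w (a j) \<le> ereal (s j)"
proof -
  obtain p where p: "p < n" "j = p \<or> j = Suc p"
  proof (cases "j = n")
    case True
    then show ?thesis using that[of "n - 1"] n by simp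
  next
    case False
    then show ?thesis using that[of j] j by simp
  qed
  have line: "chord a p (Suc p) s k = s p + (s (Suc p) - s p) / (a (Suc p) - a p) * (a k - a p)" for k
    by (simp add: chord_def)
  have "s k \<le> chord a p (Suc p) s k" if "k \<le> n" for k
    using chord_ge_outside[OF a s, of p "Suc p" k] p that by (cases "k \<le> p") simp_all
  then have "w k \<le> ereal (chord a p (Suc p) s k)" if "k \<le> n" for k
    using w[OF that] that by (meson ereal_less_eq(3) order_trans)
  then have "conc_xi n a w (a j) \<le> ereal (chord a p (Suc p) s j)"
    unfolding line by (rule conc_xi_le_affine)
  also have "chord a p (Suc p) s j = s j"
    using p strict_mono_on_lessD[OF a, of p "Suc p"] by (auto simp: chord_def)
  finally show ?thesis .
qed

text \<open>Affine bounds pass from \<open>w\<close> to its envelope. The bounds \<open>a k\<close>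
  and \<open>y\<close> fix the end values and, by concavity, confine the slopes to [0, 1].
  Minimality holds because the values of any competitor bound the envelope at the nodes.\<close>

lemma conc_xi_least_in_Q_simplex:
  fixes w :: "nat \<Rightarrow> ereal" and y :: real
  assumes a: "strict_mono_on {0..n} a" and n: "0 < n"
    and w0: "w 0 = ereal (a 0)" and wn: "w n = ereal y"
    and w_le: "\<And>k. k \<le> n \<Longrightarrow> w k \<le> ereal (min (a k) y)"
  defines "e \<equiv> \<lambda>j. if j \<le> n then real_of_ereal (conc_xi n a w (a j)) else 0"
  shows "e \<in> Q_simplex n a" "e n = y" "\<And>j. j \<le> n \<Longrightarrow> w j \<le> ereal (e j)"
    and "\<And>s j. s \<in> Q_simplex n a \<Longrightarrow> (\<And>k. k \<le> n \<Longrightarrow> w k \<le> ereal (s k)) \<Longrightarrow> e j \<le> s j"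
proof -
  let ?c = "\<lambda>j. conc_xi n a w (a j)" and ?S = "{a 0..a n}"
  have a_S: "a j \<in> ?S" if "j \<le> n" for j
    using strict_mono_on_leD[OF a] that by auto
  have w_c: "w j \<le> ?c j" if "j \<le> n" for j
    using conc_ge[OF a_S[OF that], of "xi n a w"] xi_grid[OF a that] by (simp add: conc_xi_def)
  have c_a: "?c j \<le> ereal (a j)" if "j \<le> n" for j
    using conc_xi_le_affine[of n w 0 1 a 0 "a j"] w_le by simp
  have c_y: "?c j \<le> ereal y" if "j \<le> n" for j
    using conc_xi_le_affine[of n w y 0 a 0 "a j"] w_le by simp
  have hyp: "convex {(x, r::real). x \<in> ?S \<and> ereal r \<le> conc_xi n a w x}"
    using ereal_concave_on_conc[of ?S "xi n a w"] by (simp add: ereal_concave_on_def conc_xi_def)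
  \<comment> \<open>The values at \<open>p\<close> and \<open>q\<close> enter through real lower
    bounds because their finiteness is not known yet.\<close>
  have interp: "ereal ((a q - a m) / (a q - a p) * r + (a m - a p) / (a q - a p) * r') \<le> ?c m"
    if "p < m" "m < q" "q \<le> n" "ereal r \<le> ?c p" "ereal r' \<le> ?c q" for p m q r r'
  proof -
    have lt: "a p < a m" "a m < a q" using strict_mono_on_lessD[OF a] that by auto
    let ?v = "(a q - a m) / (a q - a p)" and ?w = "(a m - a p) / (a q - a p)"
    have sum1: "?v + ?w = 1" using lt by (simp add: add_divide_distrib[symmetric])
    have pt: "?v * a p + ?w * a q = a m"
    proof -
      have "?v * a p + ?w * a q = ((a q - a m) * a p + (a m - a p) * a q) / (a q - a p)"
        by (simp add: add_divide_distrib)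
      also have "(a q - a m) * a p + (a m - a p) * a q = a m * (a q - a p)"
        by (simp add: algebra_simps)
      finally show ?thesis using lt by simp
    qed
    have "?v *\<^sub>R (a p, r) + ?w *\<^sub>R (a q, r') \<in> {(x, r::real). x \<in> ?S \<and> ereal r \<le> conc_xi n a w x}"
      using that lt a_S sum1 by (intro convexD[OF hyp]) auto
    then show ?thesis using pt by simp
  qed
  have c0: "?c 0 = ereal (a 0)" using w_c[of 0] c_a[of 0] w0 by simp
  have cn: "?c n = ereal y" using w_c[of n] c_y[of n] wn by simp
  have fin: "?c j = ereal (e j)" if "j \<le> n" for j
  proof (cases "j = 0 \<or> j = n")
    case False
    \<comment> \<open>Interpolating between the end values bounds the envelope from below even where
      \<open>w\<close> is -\<infinity>.\<close>
    then have "?c j \<noteq> -\<infinity>"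
      using interp[of 0 j n "a 0" y] that c0 cn by auto
    moreover have "?c j \<noteq> \<infinity>" using c_y[OF that] by auto
    ultimately show ?thesis using that by (cases "?c j") (auto simp: e_def)
  qed (use c0 cn in \<open>auto simp: e_def\<close>)
  have e0: "e 0 = a 0" and en: "e n = y" using c0 cn by (auto simp: e_def)
  have e_a: "e j \<le> a j" and e_y: "e j \<le> y" if "j \<le> n" for j
    using c_a[OF that] c_y[OF that] fin[OF that] by simp_all
  have conc: "concave_seq n a e"
    unfolding concave_seq_def
  proof (intro allI impI, elim conjE)
    fix p m q assume h: "p < m" "m < q" "q \<le> n"
    have lt: "a p < a m" "a m < a q" using strict_mono_on_lessD[OF a] h by auto
    have "(a q - a m) / (a q - a p) * e p + (a m - a p) / (a q - a p) * e q \<le> e m"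
      using interp[OF h, of "e p" "e q"] fin[of p] fin[of q] fin[of m] h by simp
    then have "(a q - a m) * e p + (a m - a p) * e q \<le> e m * (a q - a p)"
      using lt by (simp add: add_divide_distrib[symmetric] pos_divide_le_eq)
    then show "(e q - e m) * (a m - a p) \<le> (e m - e p) * (a q - a m)"
      by (simp add: algebra_simps)
  qed
  have "slopes01 n a e"
    unfolding slopes01_def
  proof (intro allI impI, elim conjE)
    fix p q assume h: "p \<le> q" "q \<le> n"
    \<comment> \<open>A descent would persist up to \<open>n\<close> by concavity, against
      \<open>e q \<le> y = e n\<close>.\<close>
    have "e p \<le> e q"
    proof (cases "p = q \<or> q = n")
      case False
      then have lt: "a p < a q" "a q < a n" using strict_mono_on_lessD[OF a] h by auto
      have "(e n - e q) * (a q - a p) \<le> (e q - e p) * (a n - a q)"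
        using False h by (intro concave_seqD[OF conc]) auto
      moreover have "0 \<le> (e n - e q) * (a q - a p)"
        using lt en e_y[of q] h by simp
      ultimately have "0 \<le> (e q - e p) * (a n - a q)" by linarith
      then show ?thesis using lt by (simp add: zero_le_mult_iff)
    qed (use h en e_y[of p] in auto)
    \<comment> \<open>The slope over [p, q] is at most the slope over [0, p], which is at most 1
      because \<open>e 0 = a 0\<close> and \<open>e p \<le> a p\<close>.\<close>
    moreover have "e q - e p \<le> a q - a p"
    proof (cases "p = q \<or> p = 0")
      case False
      then have lt: "a 0 < a p" "a p < a q" using strict_mono_on_lessD[OF a] h by auto
      have "(e q - e p) * (a p - a 0) \<le> (e p - e 0) * (a q - a p)"
        using False h by (intro concave_seqD[OF conc]) auto
      also have "\<dots> \<le> (a p - a 0) * (a q - a p)"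
        using lt e0 e_a[of p] h by (intro mult_right_mono) auto
      finally show ?thesis using lt by (simp add: mult.commute)
    qed (use h e0 e_a[of q] in auto)
    ultimately show "0 \<le> e q - e p \<and> e q - e p \<le> a q - a p" by simp
  qed
  then show "e \<in> Q_simplex n a"
    unfolding Q_simplex_iff[OF a] using conc e0 by (auto simp: e_def)
  show "e n = y" by (rule en)
  show "w j \<le> ereal (e j)" if "j \<le> n" for j using w_c[OF that] fin[OF that] by simp
  show "e j \<le> s j" if "s \<in> Q_simplex n a" "\<And>k. k \<le> n \<Longrightarrow> w k \<le> ereal (s k)" for s j
  proof (cases "j \<le> n")
    case True
    then show ?thesis
      using conc_xi_le_concave_seq[OF a, of s w j] that n fin[OF True] Q_simplex_iff[OF a] by simp
  next
    case False
    then show ?thesis using that Q_simplex_iff[OF a] by (simp add: e_def)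
  qed
qed

section \<open>Maximization over sets with a least element\<close>

lemma envelope_matrix_least:
  fixes a :: "'d::finite \<Rightarrow> nat \<Rightarrow> real"
  assumes a: "\<And>i. strict_mono_on {0..n} (a i)" and n: "0 < n"
    and w: "\<And>i. w i 0 = ereal (a i 0)" "\<And>i. w i n = ereal (y $ i)"
      "\<And>i k. k \<le> n \<Longrightarrow> w i k \<le> ereal (min (a i k) (y $ i))"
  shows "envelope_matrix n a w \<in> {s \<in> Q n a. last_col n s = y \<and> (\<forall>i. \<forall>j\<le>n. w i j \<le> ereal (s i j))}"
    and "\<And>s i j. s \<in> Q n a \<Longrightarrow> (\<forall>i. \<forall>j\<le>n. w i j \<le> ereal (s i j)) \<Longrightarrow> envelope_matrix n a w i j \<le> s i j"
proof -
  note E = conc_xi_least_in_Q_simplex[OF a n w]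
  have row: "envelope_matrix n a w i
      = (\<lambda>j. if j \<le> n then real_of_ereal (conc_xi n (a i) (w i) (a i j)) else 0)" for i
    by (simp add: envelope_matrix_def)
  show "envelope_matrix n a w \<in> {s \<in> Q n a. last_col n s = y \<and> (\<forall>i. \<forall>j\<le>n. w i j \<le> ereal (s i j))}"
    using E(1-3) by (auto simp: Q_def last_col_def vec_eq_iff row)
  show "envelope_matrix n a w i j \<le> s i j"
    if "s \<in> Q n a" "\<forall>i. \<forall>j\<le>n. w i j \<le> ereal (s i j)" for s i j
    unfolding row by (rule E(4)) (use that in \<open>auto simp: Q_def\<close>)
qed

text \<open>The envelope matrix is the least element of \<open>F\<close>, and all points of
  \<open>F\<close> share the last column, so antitonicity places the maximum there. Its membership
  in \<open>F\<close> shows that the supremum is attained.\<close>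

lemma SUP_conc_Q_envelope:
  fixes a :: "'d::finite \<Rightarrow> nat \<Rightarrow> real"
  assumes a: "\<And>i. strict_mono_on {0..n} (a i)" and n: "0 < n"
    and w: "\<And>i. w i 0 = ereal (a i 0)" "\<And>i. w i n = ereal (y $ i)"
      "\<And>i k. k \<le> n \<Longrightarrow> w i k \<le> ereal (min (a i k) (y $ i))"
    and F: "F = {s \<in> Q n a. last_col n s = y \<and> (\<forall>i. \<forall>j\<le>n. w i j \<le> ereal (s i j))}"
  shows "envelope_matrix n a w \<in> F \<and> (SUP s\<in>F. conc_Q n a \<phi> s) = conc_Q n a \<phi> (envelope_matrix n a w)"
proof
  show mem: "envelope_matrix n a w \<in> F"
    unfolding F by (rule envelope_matrix_least[OF a n w])
  show "(SUP s\<in>F. conc_Q n a \<phi> s) = conc_Q n a \<phi> (envelope_matrix n a w)"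
  proof (rule antisym)
    show "(SUP s\<in>F. conc_Q n a \<phi> s) \<le> conc_Q n a \<phi> (envelope_matrix n a w)"
    proof (rule SUP_least)
      fix s assume s: "s \<in> F"
      have "last_col n (envelope_matrix n a w) = last_col n s"
        using s mem by (simp add: F)
      then show "conc_Q n a \<phi> s \<le> conc_Q n a \<phi> (envelope_matrix n a w)"
        using s mem envelope_matrix_least(2)[OF a n w, of s]
        by (intro conc_Q_antimono[OF a]) (auto simp: F last_col_def vec_eq_iff)
    qed
  qed (use mem in \<open>rule SUP_upper\<close>)
qed

section \<open>The constraints (INC) as lower bounds\<close>

text \<open>Concavity makes the slope before \<open>k\<close> at least the slope just after it,
  which is at least 1 by hypothesis. So \<open>s\<close> rises with slope 1 from its start
  \<open>s 0 = a 0\<close>.\<close>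

lemma full_increment_propagates:
  assumes a: "strict_mono_on {0..n} a" and s: "s \<in> Q_simplex n a"
    and k: "k < n" "a (Suc k) - a k \<le> s (Suc k) - s k" and j: "j \<le> Suc k"
  shows "s j = a j"
proof -
  have S: "concave_seq n a s" "slopes01 n a s" "s 0 = a 0" using s Q_simplex_iff[OF a] by auto
  have lt: "a k < a (Suc k)" using strict_mono_on_lessD[OF a, of k "Suc k"] k by simp
  have "a k \<le> s k"
  proof (cases "k = 0")
    case False
    then have "a 0 < a k" using strict_mono_on_lessD[OF a, of 0 k] k by simp
    then have "(a (Suc k) - a k) * (a k - a 0) \<le> (s (Suc k) - s k) * (a k - a 0)"
      using k by (intro mult_right_mono) auto
    also have "\<dots> \<le> (s k - s 0) * (a (Suc k) - a k)"
      using False k by (intro concave_seqD[OF S(1)]) auto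
    finally show ?thesis using lt S(3) by (simp add: mult.commute)
  qed (use S in simp)
  then show ?thesis
    using k(2) slopes01D[OF S(2), of j "Suc k"] slopes01D[OF S(2), of 0 j] S(3) k j by simp
qed

text \<open>Mirror image: after a slope that is not positive, concavity allows no increase, and
  monotonicity no decrease.\<close>

lemma zero_increment_propagates:
  assumes a: "strict_mono_on {0..n} a" and s: "s \<in> Q_simplex n a"
    and k: "k < n" "s (Suc k) \<le> s k" and j: "k \<le> j" "j \<le> n"
  shows "s j = s n"
proof -
  have S: "concave_seq n a s" "slopes01 n a s" using s Q_simplex_iff[OF a] by auto
  have "s n \<le> s k"
  proof (cases "Suc k = n")
    case False
    then have lt: "a k < a (Suc k)" "a (Suc k) < a n"
      using strict_mono_on_lessD[OF a, of k "Suc k"] strict_mono_on_lessD[OF a, of "Suc k" n] k by auto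
    have "(s n - s (Suc k)) * (a (Suc k) - a k) \<le> (s (Suc k) - s k) * (a n - a (Suc k))"
      using False k by (intro concave_seqD[OF S(1)]) auto
    also have "\<dots> \<le> 0" using k lt by (simp add: mult_le_0_iff)
    finally show ?thesis using lt k by (simp add: mult_le_0_iff)
  qed (use k in simp)
  then show ?thesis
    using slopes01D[OF S(2), of k j] slopes01D[OF S(2), of j n] j by simp
qed

text \<open>At a breakpoint, \<open>\<delta> = 1\<close> forces slope 1 on the grid interval ending
  there, hence agreement with \<open>a\<close> up to it; \<open>\<delta> = 0\<close> forces slope 0
  on the interval starting there, hence the final value from it on. The position of \<open>y\<close>
  among the breakpoints turns these alternatives into the bounds \<open>u_hat\<close>.\<close>

lemma INC_iff_u_hat_le:
  fixes a :: "'d::finite \<Rightarrow> nat \<Rightarrow> real"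
  assumes a: "\<And>i. strict_mono_on {0..n} (a i)"
    and tau_ends: "\<And>i. \<tau> i 0 = 0" "\<And>i. \<tau> i (l i) = n"
    and tau_incr: "\<And>i. strict_mono_on {0..l i} (\<tau> i)"
    and t: "\<And>i. t i \<in> {1..l i}"
    and y: "y \<in> subcube a \<tau> t"
    and s: "s \<in> Q n a" "last_col n s = y"
  shows "(\<exists>\<delta>. (Z n a s, \<delta>) \<in> INC n l \<tau>) \<longleftrightarrow> (\<forall>i. \<forall>j\<le>n. u_hat a \<tau> t y i j \<le> ereal (s i j))"
proof -
  have Qi: "s i \<in> Q_simplex n (a i)" for i using s by (simp add: Q_def)
  have S: "concave_seq n (a i) (s i)" "slopes01 n (a i) (s i)" "s i 0 = a i 0" for i
    using Qi Q_simplex_iff[OF a] by auto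
  have sn: "s i n = y $ i" for i using s by (auto simp: last_col_def)
  have H: "a i (\<tau> i (t i - 1)) \<le> y $ i" "y $ i \<le> a i (\<tau> i (t i))" for i
    using y by (auto simp: subcube_def)
  have Delta: "Z n a s i \<in> Delta n" for i
    by (rule Z_row_in_Delta[where a = a and i = i]) (use a S in auto)
  have tau_less: "\<tau> i v < \<tau> i w" if "v < w" "w \<le> l i" for i v w
    using tau_incr[of i] that by (auto simp: strict_mono_on_def)
  have tau_le: "\<tau> i v \<le> \<tau> i w" if "v \<le> w" "w \<le> l i" for i v w
    using tau_less[of v w i] that by (cases "v = w") auto
  have tau_n: "\<tau> i v \<le> n" if "v \<le> l i" for i v
    using tau_le[of v "l i" i] that tau_ends by simp
  have Z_Suc: "Z n a s i (Suc k) \<ge> 1 \<longleftrightarrow> a i (Suc k) - a i k \<le> s i (Suc k) - s i k"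
    "Z n a s i (Suc k) \<le> 0 \<longleftrightarrow> s i (Suc k) \<le> s i k" if "k < n" for i k
    using strict_mono_on_lessD[OF a[of i], of k "Suc k"] that
    by (simp_all add: Z_def le_divide_eq divide_le_0_iff)
  have Z_bounds: "0 \<le> Z n a s i k \<and> Z n a s i k \<le> 1" if "k \<le> n" for i k
  proof (cases k)
    case (Suc m)
    then show ?thesis
      using slopes01D[OF S(2)[of i], of m k] strict_mono_on_lessD[OF a[of i], of m k] that
      by (simp add: Z_def)
  qed (simp add: Z_def)
  \<comment> \<open>Inner breakpoints lie strictly between 0 and \<open>n\<close>, so the grid
    intervals on both sides exist.\<close>
  have breakpoint: "\<exists>k<n. \<tau> i v = Suc k \<and> Suc k < n" if "v \<in> {1..<l i}" for i v
    using tau_less[of 0 v i] tau_less[of v "l i" i] tau_ends[of i] that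
    by (intro exI[of _ "\<tau> i v - 1"]) auto
  show ?thesis
  proof (intro iffI allI impI)
    fix i j assume "\<exists>\<delta>. (Z n a s, \<delta>) \<in> INC n l \<tau>" and j: "j \<le> n"
    then obtain \<delta> where "(Z n a s, \<delta>) \<in> INC n l \<tau>" by blast
    then have \<delta>: "\<And>v. v \<in> {1..<l i} \<Longrightarrow>
        \<delta> i v \<in> {0, 1} \<and> Z n a s i (\<tau> i v) \<ge> \<delta> i v \<and> \<delta> i v \<ge> Z n a s i (\<tau> i v + 1)"
      by (auto simp: INC_def)
    have dich: "(\<forall>k\<le>\<tau> i v. s i k = a i k) \<or> s i (\<tau> i v) = y $ i" if v: "v \<in> {1..<l i}" for v
    proof -
      obtain k where k: "k < n" "\<tau> i v = Suc k" "Suc k < n" using breakpoint[OF v] by auto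
      show ?thesis
      proof (cases "\<delta> i v = 1")
        case True
        then have "Z n a s i (Suc k) \<ge> 1" using \<delta>[OF v] k(2) by simp
        then have "a i (Suc k) - a i k \<le> s i (Suc k) - s i k" using Z_Suc(1)[OF k(1)] by blast
        then show ?thesis
          using full_increment_propagates[OF a[of i] Qi[of i] k(1)] unfolding k(2) by blast
      next
        case False
        then have "\<delta> i v = 0" using \<delta>[OF v] by blast
        then have "Z n a s i (Suc (Suc k)) \<le> 0" using \<delta>[OF v] k(2) by simp
        then have "s i (Suc (Suc k)) \<le> s i (Suc k)" using Z_Suc(2)[OF k(3)] by blast
        then have "s i (Suc k) = s i n"
          using zero_increment_propagates[OF a[of i] Qi[of i] k(3), of "Suc k"] k(3) by simp
        then show ?thesis unfolding k(2) sn by blast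
      qed
    qed
    \<comment> \<open>With \<open>t i = 1\<close> the breakpoint is 0 and carries no binary
      variable. Otherwise, if \<open>s\<close> has already reached \<open>y $ i\<close> at the
      breakpoint, it is at least \<open>a\<close> there, and slopes at most 1 extend this to smaller
      indices.\<close>
    have low: "a i j \<le> s i j" if "j \<le> \<tau> i (t i - 1)"
    proof (cases "t i = 1")
      case True
      then show ?thesis using that tau_ends S(3) by simp
    next
      case False
      then have v: "t i - 1 \<in> {1..<l i}" using t[of i] by auto
      have n: "\<tau> i (t i - 1) \<le> n" using v by (intro tau_n) auto
      show ?thesis
        using dich[OF v]
      proof
        assume "\<forall>k\<le>\<tau> i (t i - 1). s i k = a i k"
        then have "s i j = a i j" using that by blast
        then show ?thesis by simp
      next
        assume "s i (\<tau> i (t i - 1)) = y $ i"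
        then show ?thesis using H(1)[of i] slopes01D[OF S(2)[of i] that n] by linarith
      qed
    qed
    \<comment> \<open>With \<open>t i = l i\<close> the breakpoint is \<open>n\<close>. Otherwise
      either alternative gives at least \<open>y $ i\<close> at the breakpoint, and monotonicity
      carries it further.\<close>
    have high: "y $ i \<le> s i j" if "\<tau> i (t i) \<le> j"
    proof (cases "t i = l i")
      case True
      then show ?thesis using that j tau_ends(2)[of i] sn[of i] by simp
    next
      case False
      then have v: "t i \<in> {1..<l i}" using t[of i] by auto
      have "y $ i \<le> s i (\<tau> i (t i))"
        using dich[OF v]
      proof
        assume "\<forall>k\<le>\<tau> i (t i). s i k = a i k"
        then have "s i (\<tau> i (t i)) = a i (\<tau> i (t i))" by blast
        then show ?thesis using H(2)[of i] by linarith
      qed simp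
      then show ?thesis using slopes01D[OF S(2)[of i] that j] by linarith
    qed
    show "u_hat a \<tau> t y i j \<le> ereal (s i j)"
      using low high by (auto simp: u_hat_def)
  next
    assume uh: "\<forall>i. \<forall>j\<le>n. u_hat a \<tau> t y i j \<le> ereal (s i j)"
    \<comment> \<open>Breakpoints up to the lower end of the box get 1, those from its upper end on
      get 0.\<close>
    define \<delta> where "\<delta> i v = (if v < t i then 1 else 0 :: real)" for i v
    have "Z n a s i (\<tau> i v) \<ge> \<delta> i v \<and> \<delta> i v \<ge> Z n a s i (\<tau> i v + 1)" if v: "v \<in> {1..<l i}" for i v
    proof -
      obtain k where k: "k < n" "\<tau> i v = Suc k" "Suc k < n" using breakpoint[OF v] by auto
      show ?thesis
      proof (cases "v < t i")
        case True
        have le: "\<tau> i v \<le> \<tau> i (t i - 1)" using True t[of i] by (intro tau_le) auto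
        then have "a i (Suc k) \<le> s i (Suc k)" 
          using uh[rule_format, of "Suc k" i] k by (simp add: u_hat_def)
        moreover have "s i k \<le> a i k" using slopes01D[OF S(2)[of i], of 0 k] S(3)[of i] k by simp
        ultimately have "Z n a s i (\<tau> i v) \<ge> 1" using Z_Suc(1)[OF k(1), of i] k by simp
        then show ?thesis using Z_bounds[of "\<tau> i v + 1" i] k True by (simp add: \<delta>_def)
      next
        case False
        have le: "\<tau> i (t i) \<le> \<tau> i v" using False v by (intro tau_le) auto
        have lt: "\<tau> i (t i - 1) < \<tau> i (t i)" using t[of i] by (intro tau_less) auto
        have "\<not> \<tau> i v \<le> \<tau> i (t i - 1)" using le lt by simp
        then have "y $ i \<le> s i (\<tau> i v)"
          using uh[rule_format, of "\<tau> i v" i] le k by (simp add: u_hat_def)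
        \<comment> \<open>By monotonicity no entry exceeds the last one, so the increment after the
          breakpoint vanishes.\<close>
        moreover have "s i (Suc (\<tau> i v)) \<le> y $ i"
          using slopes01D[OF S(2)[of i], of "Suc (\<tau> i v)" n] sn[of i] k by simp
        ultimately have "Z n a s i (\<tau> i v + 1) \<le> 0" using Z_Suc(2)[of "\<tau> i v" i] k by simp
        then show ?thesis using Z_bounds[of "\<tau> i v" i] k False by (simp add: \<delta>_def)
      qed
    qed
    then have "(Z n a s, \<delta>) \<in> INC n l \<tau>" using Delta by (auto simp: INC_def \<delta>_def)
    then show "\<exists>\<delta>. (Z n a s, \<delta>) \<in> INC n l \<tau>" by blast
  qed
qed

section \<open>Reduction of the three maximization problems to least elements\<close>

text \<open>A point of \<open>W\<close> need not have \<open>xbar\<close> in \<open>X\<close>, so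
  feasibility of \<open>u xbar \<le> s\<close> and the starting values
  \<open>u xbar i 0 = a i 0\<close> appear as premises where they enter. With a smaller starting
  value the envelope of \<open>u_bar\<close> would start below \<open>a i 0\<close> and leave
  \<open>Q\<close>. The membership claims turn the suprema into maxima.\<close>

theorem proposition3p3:
  fixes X :: "(real^'m::finite) set"
    and f :: "real^'m \<Rightarrow> real^'d::finite"
    and fL fU :: "real^'d"
    and \<phi> :: "real^'d \<Rightarrow> real"
    and n :: nat
    and a :: "'d \<Rightarrow> nat \<Rightarrow> real"
    and l :: "'d \<Rightarrow> nat"
    and \<tau> :: "'d \<Rightarrow> nat \<Rightarrow> nat"
    and u :: "real^'m \<Rightarrow> 'd \<Rightarrow> nat \<Rightarrow> real"
    and W :: "((real^'m) \<times> (real^'d)) set"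
    and xbar :: "real^'m"
    and fbar :: "real^'d"
    and tbar :: "'d \<Rightarrow> nat"
  assumes f_range: "\<And>x i. x \<in> X \<Longrightarrow> fL $ i \<le> f x $ i \<and> f x $ i \<le> fU $ i"
    and a_ends: "\<And>i. a i 0 = fL $ i" "\<And>i. a i n = fU $ i"
    and a_incr: "\<And>i. strict_mono_on {0..n} (a i)"
    and tau_ends: "\<And>i. \<tau> i 0 = 0" "\<And>i. \<tau> i (l i) = n"
    and tau_incr: "\<And>i. strict_mono_on {0..l i} (\<tau> i)"
    and u_convex: "\<And>i j. j \<le> n \<Longrightarrow> convex_on UNIV (\<lambda>x. u x i j)"
    and u_le: "\<And>x i j. x \<in> X \<Longrightarrow> j \<le> n \<Longrightarrow> u x i j \<le> min (f x $ i) (a i j)"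
    and u_first: "\<And>x i. x \<in> X \<Longrightarrow> u x i 0 = a i 0"
    and u_last: "\<And>x i. x \<in> X \<Longrightarrow> u x i n = f x $ i"
    and W_convex: "convex W"
    and W_outer: "{(x, f x) | x. x \<in> X} \<subseteq> W"
    and bar_in_W: "(xbar, fbar) \<in> W"
    and tbar_index: "\<And>i. tbar i \<in> {1..l i}"
    and fbar_in_H: "fbar \<in> subcube a \<tau> tbar"
  shows "let F = feasible n a u W xbar fbar;
             F_Hm = feasible_Hminus n a l \<tau> W xbar fbar;
             F_H = feasible_H n a l \<tau> u W xbar fbar;
             s_bar = envelope_matrix n a (u_bar n u xbar fbar);
             s_hat = envelope_matrix n a (u_hat a \<tau> tbar fbar);
             s_star = envelope_matrix n a (u_star n a \<tau> tbar u xbar fbar)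
         in
           (F \<noteq> {} \<and> (\<forall>i. u xbar i 0 = a i 0) \<longrightarrow>
              s_bar \<in> F \<and> varphi n a \<phi> u W xbar fbar = conc_Q n a \<phi> s_bar) \<and>
           (s_hat \<in> F_Hm \<and> varphi_Hminus n a l \<tau> \<phi> W xbar fbar = conc_Q n a \<phi> s_hat) \<and>
           (F \<noteq> {} \<longrightarrow>
              s_star \<in> F_H \<and> varphi_H n a l \<tau> \<phi> u W xbar fbar = conc_Q n a \<phi> s_star) \<and>
           varphi_H n a l \<tau> \<phi> u W xbar fbar \<le> varphi n a \<phi> u W xbar fbar \<and>
           varphi_H n a l \<tau> \<phi> u W xbar fbar \<le> varphi_Hminus n a l \<tau> \<phi> W xbar fbar"
proof -
  let ?w = "u_hat a \<tau> tbar fbar" and ?v = "u_star n a \<tau> tbar u xbar fbar"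
    and ?b = "u_bar n u xbar fbar"
  define F where "F = feasible n a u W xbar fbar"
  define F_Hm where "F_Hm = feasible_Hminus n a l \<tau> W xbar fbar"
  define F_H where "F_H = feasible_H n a l \<tau> u W xbar fbar"
  \<comment> \<open>Any row will do: a nonempty block between breakpoints in it forces
    \<open>n\<close> to be positive.\<close>
  define i0 :: 'd where "i0 = undefined"
  have tau_less: "\<tau> i v < \<tau> i w" if "v < w" "w \<le> l i" for i v w
    using tau_incr[of i] that by (auto simp: strict_mono_on_def)
  have block: "\<tau> i (tbar i - 1) < \<tau> i (tbar i)" "\<tau> i (tbar i) \<le> n" for i
    using tau_less[of "tbar i - 1" "tbar i" i] tau_less[of "tbar i" "l i" i] tbar_index[of i]
      tau_ends(2)[of i]
    by (auto simp: order.order_iff_strict)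
  have n: "0 < n" using block[of i0] by simp
  have H: "a i (\<tau> i (tbar i - 1)) \<le> fbar $ i" "fbar $ i \<le> a i (\<tau> i (tbar i))" for i
    using fbar_in_H by (auto simp: subcube_def)

  have hat0: "?w i 0 = ereal (a i 0)" and hatn: "?w i n = ereal (fbar $ i)" for i
    using block[of i] by (auto simp: u_hat_def)
  have hat_le: "?w i k \<le> ereal (min (a i k) (fbar $ i))" if "k \<le> n" for i k
    using H[of i] block[of i] that strict_mono_on_leD[OF a_incr[of i], of k "\<tau> i (tbar i - 1)"]
      strict_mono_on_leD[OF a_incr[of i], of "\<tau> i (tbar i)" k]
    by (auto simp: u_hat_def)
  have F_Hm_eq: "F_Hm = {s \<in> Q n a. last_col n s = fbar \<and> (\<forall>i. \<forall>j\<le>n. ?w i j \<le> ereal (s i j))}"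
    unfolding F_Hm_def feasible_Hminus_def
    using INC_iff_u_hat_le[OF a_incr tau_ends tau_incr tbar_index fbar_in_H] bar_in_W by blast
  have hat: "envelope_matrix n a ?w \<in> F_Hm \<and>
      (SUP s\<in>F_Hm. conc_Q n a \<phi> s) = conc_Q n a \<phi> (envelope_matrix n a ?w)"
    by (rule SUP_conc_Q_envelope[OF a_incr n hat0 hatn hat_le F_Hm_eq])

  \<comment> \<open>\<open>xbar\<close> may lie outside \<open>X\<close>, so the bounds are read off
    a feasible point, whose rows stay below \<open>a\<close> and below their last entry.\<close>
  have u_le_s: "u xbar i k \<le> min (a i k) (fbar $ i)" if "F \<noteq> {}" "k \<le> n" for i k
  proof -
    obtain s where "s \<in> F" using \<open>F \<noteq> {}\<close> by blast
    then have s: "s \<in> Q n a" "last_col n s = fbar" "u xbar i k \<le> s i k"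
      using that by (auto simp: F_def feasible_def)
    then have S: "slopes01 n (a i) (s i)" "s i 0 = a i 0" "s i n = fbar $ i"
      using Q_simplex_iff[OF a_incr[of i]] by (auto simp: Q_def last_col_def)
    show ?thesis
      using slopes01D[OF S(1), of 0 k] slopes01D[OF S(1), of k n] S s that by simp
  qed
  \<comment> \<open>\<open>u_bar\<close> and \<open>u\<close> differ only at index \<open>n\<close>,
    where the prescribed last column makes both constraints true.\<close>
  have bar_iff: "(\<forall>i. \<forall>j\<le>n. ?b i j \<le> ereal (s i j)) \<longleftrightarrow> (\<forall>i. \<forall>j\<le>n. u xbar i j \<le> s i j)"
    if "F \<noteq> {}" "last_col n s = fbar" for s
  proof -
    have "s i n = fbar $ i" for i using that by (auto simp: last_col_def)
    moreover have "u xbar i n \<le> fbar $ i" for i using u_le_s[OF that(1), of n i] by simp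
    ultimately have "?b i j \<le> ereal (s i j) \<longleftrightarrow> u xbar i j \<le> s i j" for i j
      by (simp add: u_bar_def)
    then show ?thesis by simp
  qed
  have bar_le: "?b i k \<le> ereal (min (a i k) (fbar $ i))" if "F \<noteq> {}" "k \<le> n" for i k
    using u_le_s[OF that, of i] hat_le[OF that(2), of i] hatn[of i] by (auto simp: u_bar_def)

  have bar: "envelope_matrix n a ?b \<in> F \<and>
      (SUP s\<in>F. conc_Q n a \<phi> s) = conc_Q n a \<phi> (envelope_matrix n a ?b)"
    if F: "F \<noteq> {}" and u0: "\<forall>i. u xbar i 0 = a i 0"
  proof (rule SUP_conc_Q_envelope[OF a_incr n])
    show "F = {s \<in> Q n a. last_col n s = fbar \<and> (\<forall>i. \<forall>j\<le>n. ?b i j \<le> ereal (s i j))}"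
      using bar_iff[OF F] bar_in_W unfolding F_def feasible_def by blast
  qed (use n u0 bar_le[OF F] in \<open>auto simp: u_bar_def\<close>)

  have star: "envelope_matrix n a ?v \<in> F_H \<and>
      (SUP s\<in>F_H. conc_Q n a \<phi> s) = conc_Q n a \<phi> (envelope_matrix n a ?v)"
    if F: "F \<noteq> {}"
  proof (rule SUP_conc_Q_envelope[OF a_incr n])
    have v: "?v i j = max (?b i j) (?w i j)" for i j by (simp add: u_star_def)
    \<comment> \<open>\<open>u_bar\<close> may start lower, but \<open>u_hat\<close> supplies the
      starting value.\<close>
    show "?v i 0 = ereal (a i 0)" for i
      using bar_le[OF F, of 0 i] hat0[of i] unfolding v by (simp add: max_def)
    show "?v i n = ereal (fbar $ i)" for i
      using bar_le[OF F, of n i] hatn[of i] unfolding v by (simp add: max_def)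
    show "?v i k \<le> ereal (min (a i k) (fbar $ i))" if "k \<le> n" for i k
      unfolding v using bar_le[OF F that] hat_le[OF that] by (rule max.boundedI)
    show "F_H = {s \<in> Q n a. last_col n s = fbar \<and> (\<forall>i. \<forall>j\<le>n. ?v i j \<le> ereal (s i j))}"
      using bar_iff[OF F] INC_iff_u_hat_le[OF a_incr tau_ends tau_incr tbar_index fbar_in_H] bar_in_W
      unfolding F_H_def feasible_H_def v max.bounded_iff by blast
  qed

  have "F_H \<subseteq> F" "F_H \<subseteq> F_Hm"
    by (auto simp: F_H_def F_def F_Hm_def feasible_H_def feasible_def feasible_Hminus_def)
  then have "(SUP s\<in>F_H. conc_Q n a \<phi> s) \<le> (SUP s\<in>F. conc_Q n a \<phi> s)"
    "(SUP s\<in>F_H. conc_Q n a \<phi> s) \<le> (SUP s\<in>F_Hm. conc_Q n a \<phi> s)"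
    by (auto intro: SUP_subset_mono)
  then show ?thesis
    using bar hat star
    unfolding Let_def varphi_def varphi_Hminus_def varphi_H_def
      F_def[symmetric] F_Hm_def[symmetric] F_H_def[symmetric]
    by blast
qed

end
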